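(* Let $J=\mathbb{Z}$, let $X_1,X_2$ be Hilbert spaces, and let $A_{11}(n)\in\mathcal{L}(X_1)$, $A_{12}(n)\in\mathcal{L}(X_2,X_1)$, $A_{22}(n)\in\mathcal{L}(X_2)$ for $n\in\mathbb{Z}$. Suppose that the block diagonal system $$x(n+1)=\begin{pmatrix}A_{11}(n)&0\\0&A_{22}(n)\end{pmatrix}x(n),\quad n\in\mathbb{Z},$$ on $X_1\times X_2$ admits an exponential dichotomy and that $\sup_{n\in\mathbb{Z}}\|A_{12}(n)\|<+\infty$. Then the block triangular system $$x(n+1)=\begin{pmatrix}A_{11}(n)&A_{12}(n)\\0&A_{22}(n)\end{pmatrix}x(n),\quad n\in\mathbb{Z},$$ admits an exponential dichotomy.
   Context: $\mathcal{L}(X,Y)$ denotes the bounded linear operators $X\to Y$, and $\mathcal{L}(X)=\mathcal{L}(X,X)$. $X_1\times X_2$ carries the norm $\|(x_1,x_2)\|=\max\{\|x_1\|,\|x_2\|\}$ (equivalent to its Hilbert norm). Exponential dichotomy. Let $X$ be a Banach space and $(A(n))_{n\in\mathbb{Z}}\subset\mathcal{L}(X)$. For $m\ge n$ put $\Phi(m,n)=A(m-1)\cdots A(n)$ if $m>n$ and $\Phi(n,n)=\mathrm{Id}$. The system $x(n+1)=A(n)x(n)$, $n\in\mathbb{Z}$, admits an exponential dichotomy if there exist (bounded) projections $(P(n))_{n\in\mathbb{Z}}\subset\mathcal{L}(X)$ and constants $K,\alpha>0$ such that: (i) for every $n\in\mathbb{Z}$, $A(n)P(n)=P(n+1)A(n)$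 and $A(n)|_{\mathcal{N}P(n)}:\mathcal{N}P(n)\to\mathcal{N}P(n+1)$ is invertible, where $\mathcal{N}P(n)$ is the kernel of $P(n)$; (ii) $\|\Phi(m,n)P(n)\|\le Ke^{-\alpha(m-n)}$ for $m\ge n$; (iii) $\|\Phi(m,n)(\mathrm{Id}-P(n))\|\le Ke^{-\alpha(n-m)}$ for $m\le n$, where for $m\le n$, $\Phi(m,n):=(\Phi(n,m)|_{\mathcal{N}P(m)})^{-1}:\mathcal{N}P(n)\to\mathcal{N}P(m)$. *)

theory Defs
  imports "HOL-Analysis.Analysis"
begin

text \<open>
  Hilbert spaces over an arbitrary scalar field of class \<^class>\<open>real_normed_field\<close>; up to isometric
  isomorphism these fields are exactly the reals and the complex numbers. The underlying real Hilbert
  space has sort \<open>{real_inner, banach}\<close>, and the scalar multiplication is an explicit parameter. For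
  real scalars it is forced to be \<^const>\<open>scaleR\<close>. For complex scalars, the norm condition makes
  multiplication by \<open>\<i>\<close> an isometry, so that \<open>inner x y + \<i> * inner x (\<i> y)\<close> is a complex inner
  product with the same norm (linear in \<open>x\<close>, conjugate-linear in \<open>y\<close>), and every complex Hilbert
  space arises in this way.
\<close>

locale normed_scaling = vector_space scale
  for scale :: "'k::real_normed_field \<Rightarrow> 'a::real_normed_vector \<Rightarrow> 'a" +
  assumes scale_of_real: "scale (of_real r) x = r *\<^sub>R x"
    and norm_scale: "norm (scale c x) = norm c * norm x"

lemma normed_scaling_scaleR: "normed_scaling ((*\<^sub>R) :: real \<Rightarrow> 'a::real_normed_vector \<Rightarrow> 'a)"
  by unfold_locales (simp_all add: algebra_simps)

lemma normed_scaling_real_unique: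
  fixes s :: "real \<Rightarrow> 'a::real_normed_vector \<Rightarrow> 'a"
  assumes "normed_scaling s"
  shows "s = (*\<^sub>R)"
  using normed_scaling.scale_of_real[OF assms] by (auto simp: fun_eq_iff)

lemma normed_scaling_complex: "normed_scaling ((*) :: complex \<Rightarrow> complex \<Rightarrow> complex)"
  by unfold_locales (simp_all add: algebra_simps norm_mult scaleR_conv_of_real)

text \<open>
  \<^typ>\<open>'a \<Rightarrow>\<^sub>L 'b\<close> only provides real-linearity; linearity over the scalar field is imposed here.
  The operator norm does not depend on the scalar field.
\<close>

definition bounded_operators ::
    "('k::real_normed_field \<Rightarrow> 'a::real_normed_vector \<Rightarrow> 'a) \<Rightarrow> ('k \<Rightarrow> 'b::real_normed_vector \<Rightarrow> 'b)
      \<Rightarrow> ('a \<Rightarrow>\<^sub>L 'b) set" where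
  "bounded_operators s1 s2 = {T. Vector_Spaces.linear s1 s2 (blinfun_apply T)}"

definition ker :: "('a::real_normed_vector \<Rightarrow>\<^sub>L 'b::real_normed_vector) \<Rightarrow> 'a set" where
  "ker T = {x. T x = 0}"

primrec steps :: "(int \<Rightarrow> 'a \<Rightarrow>\<^sub>L 'a) \<Rightarrow> int \<Rightarrow> nat \<Rightarrow> 'a::real_normed_vector \<Rightarrow>\<^sub>L 'a" where
  "steps A n 0 = id_blinfun"
| "steps A n (Suc k) = A (n + int k) o\<^sub>L steps A n k"

text \<open>\<open>transition A m n\<close> is \<open>A (m - 1) \<cdots> A n\<close>; it is only meaningful for \<open>m \<ge> n\<close>.\<close>

definition transition :: "(int \<Rightarrow> 'a \<Rightarrow>\<^sub>L 'a) \<Rightarrow> int \<Rightarrow> int \<Rightarrow> 'a::real_normed_vector \<Rightarrow>\<^sub>L 'a" where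
  "transition A m n = steps A n (nat (m - n))"

text \<open>
  For \<open>m \<le> n\<close>: the inverse of \<open>transition A n m\<close> restricted to \<open>ker (P m)\<close>. It is only meaningful
  on \<open>ker (P n)\<close>, and only if the restriction is a bijection from \<open>ker (P m)\<close> onto \<open>ker (P n)\<close>.
\<close>

definition back_transition ::
    "(int \<Rightarrow> 'a \<Rightarrow>\<^sub>L 'a) \<Rightarrow> (int \<Rightarrow> 'a \<Rightarrow>\<^sub>L 'a) \<Rightarrow> int \<Rightarrow> int \<Rightarrow> 'a::real_normed_vector \<Rightarrow> 'a" where
  "back_transition A P m n = inv_into (ker (P m)) (blinfun_apply (transition A n m))"

text \<open>
  The last conjunct bounds the operator norm pointwise, because \<^const>\<open>back_transition\<close> is a plain
  function. Boundedness of the inverse of \<open>A n\<close> on the kernels need not be required separately: it is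
  the case \<open>m = n - 1\<close> of that conjunct.
\<close>

definition exponential_dichotomy ::
    "('k::real_normed_field \<Rightarrow> 'a::banach \<Rightarrow> 'a) \<Rightarrow> (int \<Rightarrow> 'a \<Rightarrow>\<^sub>L 'a) \<Rightarrow> bool" where
  "exponential_dichotomy s A \<longleftrightarrow>
    (\<exists>(P :: int \<Rightarrow> 'a \<Rightarrow>\<^sub>L 'a) (K :: real) (\<alpha> :: real). K > 0 \<and> \<alpha> > 0 \<and>
      (\<forall>n. P n \<in> bounded_operators s s \<and> P n o\<^sub>L P n = P n) \<and>
      (\<forall>n. A n o\<^sub>L P n = P (n + 1) o\<^sub>L A n \<and>
           bij_betw (blinfun_apply (A n)) (ker (P n)) (ker (P (n + 1)))) \<and>
      (\<forall>m n. m \<ge> n \<longrightarrow>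
           norm (transition A m n o\<^sub>L P n) \<le> K * exp (- \<alpha> * real_of_int (m - n))) \<and>
      (\<forall>m n. m \<le> n \<longrightarrow>
           (\<forall>x. norm (back_transition A P m n ((id_blinfun - P n) x))
                  \<le> K * exp (- \<alpha> * real_of_int (n - m)) * norm x)))"

text \<open>
  The product type carries the norm \<open>sqrt ((norm x)\<^sup>2 + (norm y)\<^sup>2)\<close>. Passing to the equivalent norm
  \<open>max (norm x) (norm y)\<close> only changes the constant \<open>K\<close> of a dichotomy.
\<close>

lemma max_norm_equiv:
  fixes x :: "'a::real_normed_vector" and y :: "'b::real_normed_vector"
  shows "max (norm x) (norm y) \<le> norm (x, y)"
    and "norm (x, y) \<le> 2 * max (norm x) (norm y)"
proof -
  show "max (norm x) (norm y) \<le> norm (x, y)"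
    using norm_fst_le[of x y] norm_snd_le[of y x] by simp
  show "norm (x, y) \<le> 2 * max (norm x) (norm y)"
    using norm_Pair_le[of x y] by linarith
qed

lift_definition block_operator ::
    "('a \<Rightarrow>\<^sub>L 'a) \<Rightarrow> ('b \<Rightarrow>\<^sub>L 'a) \<Rightarrow> ('a \<Rightarrow>\<^sub>L 'b) \<Rightarrow> ('b \<Rightarrow>\<^sub>L 'b) \<Rightarrow>
      ('a::real_normed_vector \<times> 'b::real_normed_vector) \<Rightarrow>\<^sub>L ('a \<times> 'b)" is
  "\<lambda>B11 B12 B21 B22 v. (B11 (fst v) + B12 (snd v), B21 (fst v) + B22 (snd v))"
  by (intro bounded_linear_Pair bounded_linear_add)
    (auto intro: bounded_linear_compose bounded_linear_fst bounded_linear_snd)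

end

theory Submission
  imports Defs
begin

text \<open>
  A system \<open>A\<close> has an exponential dichotomy iff it has a Green kernel: operators \<open>G m n\<close>, decaying
  exponentially in \<open>\<bar>m - n\<bar>\<close>, that form a two-sided inverse of
  \<open>(x n) \<mapsto> (x (n + 1) - A n (x n))\<close>; the projections are then \<open>G n n\<close>. For the block diagonal system,
  uniqueness of bounded entire solutions makes the lower left block of \<open>G\<close> vanish. With \<open>N\<close> the strictly upper
  triangular part this gives \<open>N j G(j, k) N i = 0\<close>, so the Neumann series for the perturbed kernel
  stops after its second term \<open>\<Sum>k. G(m, k + 1) N k G(k, n)\<close>, which still decays
  at half the rate.
\<close>

section \<open>Scalar-linear operators and scalings on products\<close>

lemma bounded_operators_iff:
  assumes "normed_scaling s1" "normed_scaling s2"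
  shows "T \<in> bounded_operators s1 s2 \<longleftrightarrow> (\<forall>c x. T (s1 c x) = s2 c (T x))"
  using normed_scaling.axioms(1)[OF assms(1)] normed_scaling.axioms(1)[OF assms(2)]
  by (simp add: bounded_operators_def Vector_Spaces.linear_iff blinfun.add_right)

text \<open>Continuity of \<open>s c\<close> is what lets scalars pass through the infinite sums
  that define the perturbed kernel.\<close>

lemma bounded_linear_scale:
  assumes "normed_scaling s"
  shows "bounded_linear (s c)"
proof -
  interpret normed_scaling s by fact
  show ?thesis
  proof (rule bounded_linear_intro[where K = "norm c"])
    show "s c (x + y) = s c x + s c y" for x y
      by (rule scale_right_distrib)
    show "s c (r *\<^sub>R x) = r *\<^sub>R s c x" for r x
      by (simp flip: scale_of_real add: mult.commute)
    show "norm (s c x) \<le> norm x * norm c" for x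
      by (simp add: norm_scale mult.commute)
  qed
qed

lemma module_prod_scale_apply:
  assumes "normed_scaling s1" "normed_scaling s2"
  shows "module_prod.scale s1 s2 c v = (s1 c (fst v), s2 c (snd v))"
proof -
  interpret s1: normed_scaling s1 by fact
  interpret s2: normed_scaling s2 by fact
  interpret module_prod s1 s2 by unfold_locales
  show ?thesis by (rule scale_def)
qed

lemma normed_scaling_prod:
  assumes "normed_scaling s1" "normed_scaling s2"
  shows "normed_scaling (module_prod.scale s1 s2)"
proof -
  interpret s1: normed_scaling s1 by fact
  interpret s2: normed_scaling s2 by fact
  show ?thesis
    by unfold_locales
      (auto simp: module_prod_scale_apply[OF assms] s1.scale_right_distrib s2.scale_right_distrib
        s1.scale_left_distrib s2.scale_left_distrib s1.scale_of_real s2.scale_of_real norm_prod_def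
        s1.norm_scale s2.norm_scale power_mult_distrib real_sqrt_mult simp flip: distrib_left)
qed

section \<open>Transition operators\<close>

lemma transition_self: "transition A n n = id_blinfun"
  by (simp add: transition_def)

lemma transition_add_one:
  assumes "n \<le> m"
  shows "transition A (m + 1) n = A m o\<^sub>L transition A m n"
proof -
  have "nat (m + 1 - n) = Suc (nat (m - n))"
    using assms by simp
  then show ?thesis
    using assms by (simp add: transition_def)
qed

lemma transition_add_one_right:
  assumes "n + 1 \<le> m"
  shows "transition A m n = transition A m (n + 1) o\<^sub>L A n"
  using assms
proof (induction m rule: int_ge_induct)
  case base
  show ?case
    by (rule blinfun_eqI) (simp add: transition_add_one transition_self)
next
  case (step i)
  then show ?case
    by (intro blinfun_eqI) (simp add: transition_add_one)
qed

lemma bij_betw_transition: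
  fixes A P :: "int \<Rightarrow> 'a::real_normed_vector \<Rightarrow>\<^sub>L 'a"
  assumes "\<And>n. bij_betw (A n) (ker (P n)) (ker (P (n + 1)))" and "n \<le> m"
  shows "bij_betw (transition A m n) (ker (P n)) (ker (P m))"
  using assms(2)
proof (induction m rule: int_ge_induct)
  case base
  show ?case
    by (auto simp: transition_self bij_betw_def inj_on_def)
next
  case (step i)
  have "bij_betw (A i \<circ> transition A i n) (ker (P n)) (ker (P (i + 1)))"
    using step assms(1) by (blast intro: bij_betw_trans)
  then show ?case
    using step by (simp add: transition_add_one o_def cong: bij_betw_cong)
qed

section \<open>Exponential decay and summability over the integers\<close>

lemma zero_if_exp_decay:
  fixes x :: "'a::real_normed_vector"
  assumes "0 < \<alpha>" and "\<And>j::nat. norm x \<le> C * exp (- \<alpha> * j)"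
  shows "x = 0"
proof -
  have "(\<lambda>j. exp (- \<alpha>) ^ j) \<longlonglongrightarrow> 0"
    using assms(1) by (intro LIMSEQ_power_zero) simp
  then have "(\<lambda>j. C * exp (- \<alpha> * real j)) \<longlonglongrightarrow> 0"
    by (intro tendsto_mult_right_zero) (simp add: exp_of_nat_mult[symmetric] mult.commute)
  then have "norm x \<le> 0"
    using assms(2) by (intro LIMSEQ_le_const) auto
  then show ?thesis
    by simp
qed

lemma summable_on_exp_abs_int:
  fixes c :: real
  assumes "0 < c"
  shows "(\<lambda>k::int. exp (- c * real_of_int \<bar>k\<bar>)) summable_on UNIV"
proof -
  have nat: "(\<lambda>n. exp (- c * real n)) summable_on UNIV"
  proof (rule norm_summable_imp_summable_on)
    have "summable (\<lambda>n. exp (- c) ^ n)"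
      using assms by (intro summable_geometric) simp
    then show "summable (\<lambda>n. norm (exp (- c * real n)))"
      by (simp add: exp_of_nat_mult[symmetric] mult.commute)
  qed
  have "(\<lambda>k::int. exp (- c * real_of_int \<bar>k\<bar>)) summable_on range int"
    using nat by (subst summable_on_reindex) (auto simp: o_def)
  moreover have "(\<lambda>k::int. exp (- c * real_of_int \<bar>k\<bar>)) summable_on range (\<lambda>n. - int n)"
    using nat by (subst summable_on_reindex) (auto simp: o_def inj_on_def)
  then have "(\<lambda>k::int. exp (- c * real_of_int \<bar>k\<bar>)) summable_on (range (\<lambda>n. - int n) - {0})"
    by (rule summable_on_subset_banach) auto
  ultimately have "(\<lambda>k::int. exp (- c * real_of_int \<bar>k\<bar>)) summable_on (range int \<union> (range (\<lambda>n. - int n) - {0}))"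
    by (rule summable_on_Un_disjoint) auto
  moreover have "range int \<union> (range (\<lambda>n. - int n) - {0}) = UNIV"
  proof -
    have "k \<in> range int \<union> (range (\<lambda>n. - int n) - {0})" for k
      by (cases k rule: int_cases2) auto
    then show ?thesis by blast
  qed
  ultimately show ?thesis
    by simp
qed

section \<open>Green kernels and uniqueness of bounded solutions\<close>

text \<open>The index convention is that \<open>x m = (\<Sum>k. G m (k + 1) (g k))\<close> solves
  \<open>x (m + 1) = A m (x m) + g m\<close> for bounded \<open>g\<close>. Thus
  \<open>kernel_left\<close> makes each column a homogeneous solution except for a unit source on
  arrival at \<open>n\<close>, and \<open>kernel_right\<close> is the dual relation for
  rows.\<close>

locale green_kernel = normed_scaling s
  for s :: "'k::real_normed_field \<Rightarrow> 'a::banach \<Rightarrow> 'a" +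
  fixes A :: "int \<Rightarrow> 'a \<Rightarrow>\<^sub>L 'a" and G :: "int \<Rightarrow> int \<Rightarrow> 'a \<Rightarrow>\<^sub>L 'a" and K \<alpha> :: real
  assumes \<alpha>_pos: "0 < \<alpha>"
    and kernel_mem: "G m n \<in> bounded_operators s s"
    and kernel_left: "A m o\<^sub>L G m n = G (m + 1) n - (if m + 1 = n then id_blinfun else 0)"
    and kernel_right: "G m (n + 1) o\<^sub>L A n = G m n - (if m = n then id_blinfun else 0)"
    and norm_kernel: "norm (G m n) \<le> K * exp (- \<alpha> * \<bar>m - n\<bar>)"
begin

lemma K_nonneg: "0 \<le> K"
  using order_trans[OF norm_ge_zero norm_kernel[of 0 0]] by simp

lemma apply_kernel_left: "A m (G m n x) = G (m + 1) n x - (if m + 1 = n then x else 0)"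
  using arg_cong[OF kernel_left, of "\<lambda>T. blinfun_apply T x" m n] by (auto simp: blinfun.diff_left)

lemma apply_kernel_right: "G m (n + 1) (A n x) = G m n x - (if m = n then x else 0)"
  using arg_cong[OF kernel_right, of "\<lambda>T. blinfun_apply T x" m n] by (auto simp: blinfun.diff_left)

lemma norm_kernel_apply:
  assumes "norm x \<le> C"
  shows "norm (G m n x) \<le> K * C * exp (- \<alpha> * \<bar>m - n\<bar>)"
proof -
  have "norm (G m n x) \<le> norm (G m n) * norm x"
    by (rule norm_blinfun)
  also have "\<dots> \<le> (K * exp (- \<alpha> * \<bar>m - n\<bar>)) * C"
    using assms norm_kernel K_nonneg by (intro mult_mono) auto
  finally show ?thesis
    by (simp add: mult_ac)
qed

text \<open>\<open>G m n (h n)\<close> is constant on \<open>n > m\<close> and on \<open>n \<le> m\<close>, hence zero by decay, while its jump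
  at \<open>m\<close> is \<open>h m\<close>.\<close>

lemma kernel_forward_solution:
  assumes "\<And>i. n \<le> i \<Longrightarrow> h (i + 1) = A i (h i)" and "\<And>i. n \<le> i \<Longrightarrow> norm (h i) \<le> C" and "m < n"
  shows "G m n (h n) = 0"
proof (rule zero_if_exp_decay[OF \<alpha>_pos])
  fix j :: nat
  have eq: "G m (n + int j) (h (n + int j)) = G m n (h n)"
  proof (induction j)
    case (Suc j)
    have "G m (n + int j + 1) (h (n + int j + 1)) = G m (n + int j) (h (n + int j))"
      using assms by (simp add: apply_kernel_right)
    then show ?case
      using Suc by (simp add: add_ac)
  qed simp
  have C: "0 \<le> C"
    using order_trans[OF norm_ge_zero assms(2)[of n]] by simp
  have "norm (G m n (h n)) \<le> K * C * exp (- \<alpha> * \<bar>m - (n + int j)\<bar>)"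
    unfolding eq[symmetric] using assms by (intro norm_kernel_apply) auto
  also have "\<dots> \<le> K * C * exp (- \<alpha> * j)"
    using assms K_nonneg \<alpha>_pos C by (intro mult_left_mono) auto
  finally show "norm (G m n (h n)) \<le> K * C * exp (- \<alpha> * j)" .
qed

text \<open>Mirror image of the forward case: going down from \<open>n \<le> m\<close> the second
  index never crosses the jump between \<open>m\<close> and \<open>m + 1\<close>, so the value stays
  constant while the kernel decays.\<close>

lemma kernel_backward_solution:
  assumes "\<And>i. i < n \<Longrightarrow> h (i + 1) = A i (h i)" and "\<And>i. i \<le> n \<Longrightarrow> norm (h i) \<le> C" and "n \<le> m"
  shows "G m n (h n) = 0"
proof (rule zero_if_exp_decay[OF \<alpha>_pos])
  fix j :: nat
  have eq: "G m (n - int j) (h (n - int j)) = G m n (h n)"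
  proof (induction j)
    case (Suc j)
    have "G m (n - int (Suc j) + 1) (h (n - int (Suc j) + 1)) = G m (n - int (Suc j)) (h (n - int (Suc j)))"
      using assms by (subst assms(1)) (simp_all add: apply_kernel_right del: of_nat_Suc)
    then show ?case
      using Suc by simp
  qed simp
  have C: "0 \<le> C"
    using order_trans[OF norm_ge_zero assms(2)[of n]] by simp
  have "norm (G m n (h n)) \<le> K * C * exp (- \<alpha> * \<bar>m - (n - int j)\<bar>)"
    unfolding eq[symmetric] using assms by (intro norm_kernel_apply) auto
  also have "\<dots> \<le> K * C * exp (- \<alpha> * j)"
    using assms K_nonneg \<alpha>_pos C by (intro mult_left_mono) auto
  finally show "norm (G m n (h n)) \<le> K * C * exp (- \<alpha> * j)" .
qed

lemma bounded_solution_eq_zero: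
  assumes "\<And>i. h (i + 1) = A i (h i)" and "\<And>i. norm (h i) \<le> C"
  shows "h m = 0"
proof -
  have "G m (m + 1) (h (m + 1)) = 0"
    using assms by (intro kernel_forward_solution[of _ _ C]) auto
  moreover have "G m m (h m) = 0"
    using assms by (intro kernel_backward_solution[of _ _ C]) auto
  ultimately show ?thesis
    using assms(1) by (simp add: apply_kernel_right)
qed

section \<open>From a Green kernel to a dichotomy\<close>

lemma kernel_bounded: "norm (G m n x) \<le> K * norm x"
proof -
  have "norm (G m n x) \<le> K * norm x * exp (- \<alpha> * \<bar>m - n\<bar>)"
    by (rule norm_kernel_apply) simp
  also have "\<dots> \<le> K * norm x * 1"
    using K_nonneg \<alpha>_pos by (intro mult_left_mono) auto
  finally show ?thesis by simp
qed

text \<open>The column \<open>G i n x\<close> is a bounded homogeneous solution for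
  \<open>i \<ge> n\<close>, because its source acts only in the step from \<open>n - 1\<close> to
  \<open>n\<close>. The kernel annihilates initial values of such solutions.\<close>

lemma kernel_comp_diagonal:
  assumes "m < n"
  shows "G m n (G n n x) = 0"
  using assms
  by (intro kernel_forward_solution[of n "\<lambda>i. G i n x" "K * norm x"])
    (auto simp: apply_kernel_left kernel_bounded)

text \<open>By \<open>kernel_right\<close>, \<open>G n n\<close> fixes \<open>y\<close> as soon as
  \<open>G n (n + 1)\<close> kills \<open>A n y\<close>. For \<open>y = G n n x\<close> this holds
  because \<open>A n y\<close> lies in the range of the next diagonal operator.\<close>

lemma diagonal_idem: "G n n (G n n x) = G n n x"
proof -
  have "G n n (G n n x) = G n (n + 1) (A n (G n n x)) + G n n x"
    by (simp add: apply_kernel_right)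
  also have "A n (G n n x) = G (n + 1) (n + 1) (A n x)"
    by (simp add: apply_kernel_left apply_kernel_right)
  also have "G n (n + 1) \<dots> = 0"
    by (rule kernel_comp_diagonal) simp
  finally show ?thesis
    by simp
qed

text \<open>On the kernel of \<open>G m m\<close> this makes \<open>- G m n\<close> a left inverse
  of the transition from \<open>m\<close> to \<open>n\<close>, which identifies the backward
  evolution.\<close>

lemma kernel_transition:
  assumes "m < n"
  shows "G m n (transition A n m x) = G m m x - x"
proof -
  \<comment> \<open>The induction starts at \<open>m + 1\<close>: the only jump, which produces
    \<open>- x\<close>, lies between \<open>m\<close> and \<open>m + 1\<close>.\<close>
  have "G m n (transition A n m x) = G m m x - x" if "m + 1 \<le> n" for n
    using that
  proof (induction n rule: int_ge_induct)
    case base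
    show ?case
      by (simp add: transition_add_one transition_self apply_kernel_right)
  next
    case (step i)
    then show ?case
      by (simp add: transition_add_one apply_kernel_right)
  qed
  then show ?thesis
    using assms by simp
qed

lemma transition_diagonal:
  assumes "n \<le> m"
  shows "transition A m n o\<^sub>L G n n = G m n"
  using assms
proof (induction m rule: int_ge_induct)
  case base
  show ?case
    by (rule blinfun_eqI) (simp add: transition_self)
next
  case (step i)
  show ?case
  proof (rule blinfun_eqI)
    fix x
    have "transition A (i + 1) n (G n n x) = A i (G i n x)"
      using step by (simp add: transition_add_one flip: step.IH)
    then show "(transition A (i + 1) n o\<^sub>L G n n) x = G (i + 1) n x"
      using step by (simp add: apply_kernel_left)
  qed
qed

text \<open>The inverse can be read off the kernel relations: \<open>A n\<close> composed with
  \<open>G n (n + 1)\<close>, in either order, is a diagonal operator minus the identity, hence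
  minus the identity on the respective kernel.\<close>

lemma bij_betw_ker_diagonal: "bij_betw (A n) (ker (G n n)) (ker (G (n + 1) (n + 1)))"
proof (rule bij_betwI[where g = "\<lambda>x. - G n (n + 1) x"])
  show "blinfun_apply (A n) \<in> ker (G n n) \<rightarrow> ker (G (n + 1) (n + 1))"
    by (auto simp: ker_def apply_kernel_right blinfun.diff_right
        simp flip: apply_kernel_left[of n n, simplified])
  show "(\<lambda>x. - G n (n + 1) x) \<in> ker (G (n + 1) (n + 1)) \<rightarrow> ker (G n n)"
  proof
    fix x
    assume "x \<in> ker (G (n + 1) (n + 1))"
    then have "A n (G n (n + 1) x) = - x"
      by (simp add: apply_kernel_left ker_def)
    then have "G n n (G n (n + 1) x) = 0"
      using apply_kernel_right[of n n "G n (n + 1) x"] by (simp add: blinfun.minus_right)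
    then show "- G n (n + 1) x \<in> ker (G n n)"
      by (simp add: ker_def blinfun.minus_right)
  qed
  show "- G n (n + 1) (A n x) = x" if "x \<in> ker (G n n)" for x
    using that by (simp add: apply_kernel_right ker_def)
  show "A n (- G n (n + 1) x) = x" if "x \<in> ker (G (n + 1) (n + 1))" for x
    using that by (simp add: apply_kernel_left ker_def blinfun.minus_right)
qed

lemma back_transition_diagonal:
  assumes "m < n" and "x \<in> ker (G n n)"
  shows "back_transition A (\<lambda>n. G n n) m n x = - G m n x"
proof -
  have bij: "bij_betw (transition A n m) (ker (G m m)) (ker (G n n))"
    using bij_betw_transition[of A "\<lambda>n. G n n", OF bij_betw_ker_diagonal] assms by simp
  then obtain y where y: "y \<in> ker (G m m)" "x = transition A n m y"
    using assms(2) unfolding bij_betw_def by blast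
  then show ?thesis
    using bij assms(1)
    by (simp add: back_transition_def bij_betw_def inv_into_f_f kernel_transition)
      (simp add: ker_def)
qed

lemma exponential_dichotomy: "exponential_dichotomy s A"
  unfolding exponential_dichotomy_def
\<comment> \<open>The extra 1 pays for the identity in \<open>id_blinfun - G n n\<close> when
  \<open>m = n\<close>, and makes the constant positive where only \<open>0 \<le> K\<close> is
  known.\<close>
proof (rule exI[of _ "\<lambda>n. G n n"], rule exI[of _ "K + 1"], rule exI[of _ \<alpha>], intro conjI allI impI)
  show "0 < K + 1" "0 < \<alpha>"
    using K_nonneg \<alpha>_pos by auto
  show "G n n \<in> bounded_operators s s" for n
    by (rule kernel_mem)
  show "G n n o\<^sub>L G n n = G n n" for n
    by (rule blinfun_eqI) (simp add: diagonal_idem)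
  show "A n o\<^sub>L G n n = G (n + 1) (n + 1) o\<^sub>L A n" for n
    by (simp add: kernel_left kernel_right)
  show "bij_betw (A n) (ker (G n n)) (ker (G (n + 1) (n + 1)))" for n
    by (rule bij_betw_ker_diagonal)
  show "norm (transition A m n o\<^sub>L G n n) \<le> (K + 1) * exp (- \<alpha> * real_of_int (m - n))" if "n \<le> m" for m n
  proof -
    have "norm (G m n) \<le> K * exp (- \<alpha> * real_of_int (m - n))"
      using norm_kernel[of m n] that by simp
    also have "\<dots> \<le> (K + 1) * exp (- \<alpha> * real_of_int (m - n))"
      by (intro mult_right_mono) auto
    finally show ?thesis
      using that by (simp add: transition_diagonal)
  qed
  fix m n :: int and x :: 'a
  assume mn: "m \<le> n"
  define y where "y = (id_blinfun - G n n) x"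
  have y: "y \<in> ker (G n n)"
    by (simp add: y_def ker_def blinfun.diff_left blinfun.diff_right diagonal_idem)
  have "norm (back_transition A (\<lambda>n. G n n) m n y) \<le> (K + 1) * exp (- \<alpha> * real_of_int (n - m)) * norm x"
  proof (cases "m = n")
    case True
    have "back_transition A (\<lambda>n. G n n) m n y = y"
      using y True by (simp add: back_transition_def transition_self inv_into_f_eq)
    moreover have "norm y \<le> norm x + K * norm x"
      using kernel_bounded[of n n x] norm_triangle_ineq4[of x "G n n x"]
      by (simp add: y_def blinfun.diff_left)
    ultimately show ?thesis
      using True by (simp add: algebra_simps)
  next
    case False
    then have "m < n" using mn by simp
    \<comment> \<open>The part \<open>G n n x\<close> of \<open>y\<close> drops out by
      \<open>kernel_comp_diagonal\<close>, so the decay of \<open>G m n\<close> bounds the result by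
      \<open>norm x\<close>.\<close>
    then have "back_transition A (\<lambda>n. G n n) m n y = - G m n x"
      using y by (simp add: back_transition_diagonal)
        (simp add: y_def blinfun.diff_left blinfun.diff_right kernel_comp_diagonal)
    then have "norm (back_transition A (\<lambda>n. G n n) m n y) \<le> K * norm x * exp (- \<alpha> * \<bar>m - n\<bar>)"
      using norm_kernel_apply[of x "norm x" m n] by simp
    also have "\<dots> \<le> (K + 1) * norm x * exp (- \<alpha> * \<bar>m - n\<bar>)"
      by (intro mult_right_mono) auto
    finally show ?thesis
      using mn by (simp add: mult_ac)
  qed
  then show "norm (back_transition A (\<lambda>n. G n n) m n ((id_blinfun - G n n) x))
      \<le> (K + 1) * exp (- \<alpha> * real_of_int (n - m)) * norm x"
    by (simp add: y_def)
qed

section \<open>Perturbation of a Green kernel\<close>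

text \<open>No smallness of \<open>N\<close> enters: \<open>nilpotent\<close> removes all terms of
  second order, so the kernel of the perturbed system is exactly \<open>G + F\<close>, with
  \<open>F\<close> the first-order correction.\<close>

lemma perturbed_green_kernel:
  fixes N :: "int \<Rightarrow> 'a \<Rightarrow>\<^sub>L 'a"
  assumes N_mem: "\<And>n. N n \<in> bounded_operators s s"
    and N_bound: "\<And>n. norm (N n) \<le> M"
    and nilpotent: "\<And>i j k x. N j (G j k (N i x)) = 0"
  shows "\<exists>G' K'. green_kernel s (\<lambda>n. A n + N n) G' K' (\<alpha> / 2)"
proof -
  have M: "0 \<le> M"
    using order_trans[OF norm_ge_zero N_bound[of 0]] .
  define c where "c = \<alpha> / 2"
  have c: "0 < c" "\<alpha> = 2 * c"
    using \<alpha>_pos by (auto simp: c_def)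
  define f where "f m n k = G m (k + 1) o\<^sub>L (N k o\<^sub>L G k n)" for m n k
  define F where "F m n = infsum (f m n) UNIV" for m n
  define S where "S = infsum (\<lambda>k::int. exp (- c * real_of_int \<bar>k\<bar>)) UNIV"
  \<comment> \<open>The factor \<open>exp c\<close> compensates the shift from \<open>k\<close> to
    \<open>k + 1\<close> in \<open>f\<close>.\<close>
  define B where "B = K * (M * K) * exp c"
  have f_bound: "norm (f m n k) \<le> B * exp (- c * \<bar>m - n\<bar>) * exp (- c * real_of_int \<bar>k - n\<bar>)" for m n k
  proof -
    have "norm (f m n k) \<le> norm (G m (k + 1)) * (norm (N k) * norm (G k n))"
      unfolding f_def
      by (intro order_trans[OF norm_blinfun_compose] mult_left_mono norm_blinfun_compose) auto
    also have "\<dots> \<le> (K * exp (- \<alpha> * \<bar>m - (k + 1)\<bar>)) * (M * (K * exp (- \<alpha> * \<bar>k - n\<bar>)))"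
      using K_nonneg M by (intro mult_mono norm_kernel N_bound) auto
    also have "\<dots> = K * (M * K) * exp (- \<alpha> * \<bar>m - (k + 1)\<bar> - \<alpha> * \<bar>k - n\<bar>)"
      by (simp add: exp_diff exp_minus field_simps)
    also have "\<dots> \<le> K * (M * K) * exp (c - c * \<bar>m - n\<bar> - c * \<bar>k - n\<bar>)"
    proof (intro mult_left_mono)
      \<comment> \<open>Triangle inequality through \<open>k + 1\<close> and \<open>k\<close>. Since
        \<open>\<alpha> = 2 * c\<close>, the available decay covers both the rate \<open>c\<close>
        in \<open>m - n\<close> and a factor summable over \<open>k\<close>.\<close>
      have "\<bar>m - n\<bar> + \<bar>k - n\<bar> \<le> 1 + 2 * \<bar>m - (k + 1)\<bar> + 2 * \<bar>k - n\<bar>"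
        by (smt (verit))
      then have "real_of_int (\<bar>m - n\<bar> + \<bar>k - n\<bar>) \<le> real_of_int (1 + 2 * \<bar>m - (k + 1)\<bar> + 2 * \<bar>k - n\<bar>)"
        by (simp only: of_int_le_iff)
      then have "c * real_of_int (\<bar>m - n\<bar> + \<bar>k - n\<bar>) \<le> c * real_of_int (1 + 2 * \<bar>m - (k + 1)\<bar> + 2 * \<bar>k - n\<bar>)"
        using c by (intro mult_left_mono) auto
      then show "exp (- \<alpha> * \<bar>m - (k + 1)\<bar> - \<alpha> * \<bar>k - n\<bar>) \<le> exp (c - c * \<bar>m - n\<bar> - c * \<bar>k - n\<bar>)"
        unfolding c(2) by (simp add: algebra_simps)
    qed (use K_nonneg M in auto)
    finally show ?thesis
      by (simp add: B_def exp_diff exp_minus exp_add field_simps)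
  qed
  have bound_sum: "((\<lambda>k. B * exp (- c * \<bar>m - n\<bar>) * exp (- c * real_of_int \<bar>k - n\<bar>))
      has_sum (B * exp (- c * \<bar>m - n\<bar>) * S)) UNIV" for m n :: int
  proof (rule has_sum_cmult_right)
    have "((\<lambda>k::int. exp (- c * real_of_int \<bar>k\<bar>)) has_sum S) UNIV"
      unfolding S_def using summable_on_exp_abs_int[OF c(1)] by (rule has_sum_infsum)
    moreover have "bij_betw (\<lambda>k. k - n) UNIV UNIV"
      by (rule bij_betwI[where g = "\<lambda>k. k + n"]) auto
    ultimately show "((\<lambda>k. exp (- c * real_of_int \<bar>k - n\<bar>)) has_sum S) UNIV"
      by (rule has_sum_reindex_bij_betw[THEN iffD2, rotated])
  qed
  have F: "(f m n has_sum F m n) UNIV" for m n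
    unfolding F_def
    by (rule has_sum_infsum[OF abs_summable_summable])
      (rule Infinite_Sum.abs_summable_on_comparison_test'[OF has_sum_imp_summable[OF bound_sum] f_bound])
  have F_apply: "((\<lambda>k. f m n k x) has_sum F m n x) UNIV" for m n x
    by (rule has_sum_bounded_linear[OF blinfun.bounded_linear_left F])
  have F_bound: "norm (F m n) \<le> B * exp (- c * \<bar>m - n\<bar>) * S" for m n
    using f_bound by (intro norm_infsum_le[OF F bound_sum]) auto

  have s: "normed_scaling s"
    by unfold_locales
  have commute: "G m n (s a x) = s a (G m n x)" "N n (s a x) = s a (N n x)" for m n a x
    using kernel_mem N_mem by (auto simp: bounded_operators_iff[OF s s])
  \<comment> \<open>The identity term of \<open>kernel_left\<close> hits only the summand
    \<open>k = m\<close>; this is the source of the correction \<open>- N m (G m n x)\<close>. In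
    \<open>F_right\<close> the summand hit is \<open>k = n\<close>.\<close>
  have F_left: "A m (F m n x) = F (m + 1) n x - N m (G m n x)" for m n x
  proof (rule has_sum_unique)
    show "((\<lambda>k. A m (f m n k x)) has_sum A m (F m n x)) UNIV"
      by (rule has_sum_bounded_linear[OF blinfun.bounded_linear_right F_apply])
    have "((\<lambda>k. if k = m then - N m (G m n x) else 0) has_sum (- N m (G m n x))) UNIV"
      by (rule has_sum_finite_neutralI[of "{m}"]) auto
    from has_sum_add[OF F_apply this]
    show "((\<lambda>k. A m (f m n k x)) has_sum (F (m + 1) n x - N m (G m n x))) UNIV"
      unfolding diff_conv_add_uminus
      by (rule has_sum_cong[THEN iffD1, rotated]) (auto simp: f_def apply_kernel_left)
  qed
  have F_right: "F m (n + 1) (A n x) = F m n x - G m (n + 1) (N n x)" for m n x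
  proof (rule has_sum_unique)
    show "((\<lambda>k. f m (n + 1) k (A n x)) has_sum F m (n + 1) (A n x)) UNIV"
      by (rule F_apply)
    have "((\<lambda>k. if k = n then - G m (n + 1) (N n x) else 0) has_sum (- G m (n + 1) (N n x))) UNIV"
      by (rule has_sum_finite_neutralI[of "{n}"]) auto
    from has_sum_add[OF F_apply this]
    show "((\<lambda>k. f m (n + 1) k (A n x)) has_sum (F m n x - G m (n + 1) (N n x))) UNIV"
      unfolding diff_conv_add_uminus
      by (rule has_sum_cong[THEN iffD1, rotated])
        (auto simp: f_def apply_kernel_right blinfun.diff_right)
  qed
  \<comment> \<open>Every summand of \<open>N m (F m n x)\<close>, and likewise of
    \<open>F m n (N j x)\<close>, contains a product of the form excluded by
    \<open>nilpotent\<close>.\<close>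
  have NF: "N j (F m n x) = 0" if "j = m" for j m n x
  proof (rule has_sum_unique)
    show "((\<lambda>k. N j (f m n k x)) has_sum N j (F m n x)) UNIV"
      by (rule has_sum_bounded_linear[OF blinfun.bounded_linear_right F_apply])
    show "((\<lambda>k. N j (f m n k x)) has_sum 0) UNIV"
      using that by (simp add: f_def nilpotent)
  qed
  have FN: "F m n (N j x) = 0" for j m n x
  proof (rule has_sum_unique)
    show "((\<lambda>k. f m n k (N j x)) has_sum F m n (N j x)) UNIV"
      by (rule F_apply)
    show "((\<lambda>k. f m n k (N j x)) has_sum 0) UNIV"
      by (simp add: f_def nilpotent)
  qed
  have F_mem: "F m n (s a x) = s a (F m n x)" for m n a x
  proof (rule has_sum_unique)
    show "((\<lambda>k. f m n k (s a x)) has_sum F m n (s a x)) UNIV"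
      by (rule F_apply)
    show "((\<lambda>k. f m n k (s a x)) has_sum s a (F m n x)) UNIV"
      using has_sum_bounded_linear[OF bounded_linear_scale[OF s] F_apply]
      by (simp add: f_def commute)
  qed

  have "green_kernel s (\<lambda>n. A n + N n) (\<lambda>m n. G m n + F m n) (K + B * S) c"
  proof unfold_locales
    fix m n :: int
    show "0 < c" by (rule c)
    show "G m n + F m n \<in> bounded_operators s s"
      by (simp add: bounded_operators_iff[OF s s] blinfun.add_left commute F_mem scale_right_distrib)
    \<comment> \<open>The term \<open>N m (G m n x)\<close> cancels against the correction in
      \<open>F_left\<close>, and \<open>NF\<close> removes the remaining one. The right-hand
      relation works the same way with \<open>F_right\<close> and \<open>FN\<close>.\<close>
    show "(A m + N m) o\<^sub>L (G m n + F m n)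
        = G (m + 1) n + F (m + 1) n - (if m + 1 = n then id_blinfun else 0)"
      by (rule blinfun_eqI)
        (simp add: blinfun.add_left blinfun.add_right blinfun.diff_left apply_kernel_left F_left NF)
    show "(G m (n + 1) + F m (n + 1)) o\<^sub>L (A n + N n)
        = G m n + F m n - (if m = n then id_blinfun else 0)"
      by (rule blinfun_eqI)
        (simp add: blinfun.add_left blinfun.add_right blinfun.diff_left apply_kernel_right F_right FN)
    have "norm (G m n + F m n) \<le> K * exp (- \<alpha> * \<bar>m - n\<bar>) + B * exp (- c * \<bar>m - n\<bar>) * S"
      by (intro norm_triangle_mono norm_kernel F_bound)
    also have "K * exp (- \<alpha> * \<bar>m - n\<bar>) \<le> K * exp (- c * \<bar>m - n\<bar>)"
      using K_nonneg c by (intro mult_left_mono) (auto intro!: mult_right_mono)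
    finally show "norm (G m n + F m n) \<le> (K + B * S) * exp (- c * \<bar>m - n\<bar>)"
      by (simp add: algebra_simps)
  qed
  then show ?thesis
    unfolding c_def by blast
qed

end

section \<open>From a dichotomy to a Green kernel\<close>

text \<open>The kernel evolves the range of \<open>P n\<close> forward from time \<open>n\<close>
  and, with a minus sign, the kernel of \<open>P n\<close> backward. The two branches differ at
  \<open>n\<close> by \<open>P n + (id_blinfun - P n)\<close>, which is the required unit
  jump.\<close>

lemma exponential_dichotomy_imp_green_kernel:
  assumes s: "normed_scaling s"
    and A_mem: "\<And>n. A n \<in> bounded_operators s s"
    and dich: "exponential_dichotomy s A"
  shows "\<exists>G K \<alpha>. green_kernel s A G K \<alpha>"
proof -
  interpret normed_scaling s by fact
  obtain P K \<alpha> where K: "0 < K" and \<alpha>: "0 < \<alpha>"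
    and P_mem: "\<And>n. P n \<in> bounded_operators s s" and idem: "\<And>n. P n o\<^sub>L P n = P n"
    and comm: "\<And>n. A n o\<^sub>L P n = P (n + 1) o\<^sub>L A n"
    and bij: "\<And>n. bij_betw (A n) (ker (P n)) (ker (P (n + 1)))"
    and forward: "\<And>m n. n \<le> m \<Longrightarrow> norm (transition A m n o\<^sub>L P n) \<le> K * exp (- \<alpha> * real_of_int (m - n))"
    and backward: "\<And>m n x. m \<le> n \<Longrightarrow> norm (back_transition A P m n ((id_blinfun - P n) x))
        \<le> K * exp (- \<alpha> * real_of_int (n - m)) * norm x"
    using dich unfolding exponential_dichotomy_def
  proof (elim exE conjE, goal_cases)
    case (1 P K \<alpha>)
    from 1(2-) show ?case
      by (intro 1(1)[of K \<alpha> P]) blast+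
  qed
  have A_scale: "A n (s a x) = s a (A n x)" and P_scale: "P n (s a x) = s a (P n x)" for n a x
    using A_mem P_mem by (auto simp: bounded_operators_iff[OF s s])
  have T_scale: "transition A m n (s a x) = s a (transition A m n x)" if "n \<le> m" for m n a x
    using that
    by (induction m rule: int_ge_induct) (auto simp: transition_self transition_add_one A_scale)
  have PP: "P n (P n x) = P n x" for n x
    using arg_cong[OF idem, of "\<lambda>T. blinfun_apply T x"] by simp
  have AP: "P (n + 1) (A n x) = A n (P n x)" for n x
    using arg_cong[OF comm, of "\<lambda>T. blinfun_apply T x"] by simp
  \<comment> \<open>Identities for the backward evolution are checked below after transporting both
    sides forward again, where they become identities for \<open>x - P n x\<close>.\<close>
  have inj: "x = y" if "m \<le> n" "P m x = 0" "P m y = 0" "transition A n m x = transition A n m y" for m n x y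
    using bij_betw_transition[of A P, OF bij that(1)] that(2-4)
    by (auto simp: bij_betw_def ker_def dest: inj_onD)

  define b where "b m n x = back_transition A P m n ((id_blinfun - P n) x)" for m n x
  have b: "P m (b m n x) = 0" "transition A n m (b m n x) = x - P n x" if "m \<le> n" for m n x
  proof -
    have "(id_blinfun - P n) x \<in> transition A n m ` ker (P m)"
      using bij_betw_transition[of A P, OF bij that]
      by (simp add: bij_betw_def) (simp add: ker_def blinfun.diff_left blinfun.diff_right PP)
    from inv_into_into[OF this] f_inv_into_f[OF this]
    show "P m (b m n x) = 0" "transition A n m (b m n x) = x - P n x"
      by (simp_all add: b_def back_transition_def ker_def blinfun.diff_left)
  qed
  \<comment> \<open>\<open>back_transition\<close> is a bare \<open>inv_into\<close>, so linearity
    has to be recovered before \<open>Blinfun\<close> can be applied meaningfully.\<close>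
  have b_linear: "bounded_linear (b m n)" if "m \<le> n" for m n
  proof (rule bounded_linear_intro[where K = "K * exp (- \<alpha> * real_of_int (n - m))"])
    show "b m n (x + y) = b m n x + b m n y" for x y
      by (rule inj[OF that]) (simp_all add: b[OF that] blinfun.add_right)
    show "b m n (r *\<^sub>R x) = r *\<^sub>R b m n x" for r x
      by (rule inj[OF that]) (simp_all add: b[OF that] blinfun.scaleR_right scaleR_diff_right)
    show "norm (b m n x) \<le> norm x * (K * exp (- \<alpha> * real_of_int (n - m)))" for x
      using backward[OF that] by (simp add: b_def mult_ac)
  qed
  have b_scale: "b m n (s a x) = s a (b m n x)" if "m \<le> n" for m n a x
    by (rule inj[OF that]) (simp_all add: b[OF that] P_scale T_scale[OF that] scale_right_diff_distrib)
  have b_left: "A m (b m n x) = b (m + 1) n x" if "m + 1 \<le> n" for m n x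
  proof (rule inj[OF that])
    have "transition A n (m + 1) (A m (b m n x)) = transition A n m (b m n x)"
      using transition_add_one_right[OF that, of A] by simp
    then show "transition A n (m + 1) (A m (b m n x)) = transition A n (m + 1) (b (m + 1) n x)"
      using that by (simp add: b)
  qed (use that in \<open>auto simp: b AP\<close>)
  have b_right: "b m (n + 1) (A n x) = b m n x" if "m \<le> n" for m n x
  proof (rule inj[of m "n + 1"])
    show "transition A (n + 1) m (b m (n + 1) (A n x)) = transition A (n + 1) m (b m n x)"
      using that by (subst b(2)) (auto simp: transition_add_one b AP blinfun.diff_right)
  qed (use that in \<open>auto simp: b\<close>)

  \<comment> \<open>The diagonal belongs to the forward branch, so \<open>G n n = P n\<close>;
    \<open>b_refl\<close> supplies the value of the other branch there.\<close>
  define G where "G m n = (if n \<le> m then transition A m n o\<^sub>L P n else - Blinfun (b m n))" for m n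
  have G_ge: "G m n x = transition A m n (P n x)" if "n \<le> m" for m n x
    using that by (simp add: G_def)
  have G_lt: "G m n x = - b m n x" if "m < n" for m n x
    using that b_linear[of m n] by (simp add: G_def blinfun.minus_left bounded_linear_Blinfun_apply)
  have b_refl: "b n n x = x - P n x" for n x
    using b(2)[of n n x] by (simp add: transition_self)
  have "green_kernel s A G K \<alpha>"
  proof unfold_locales
    fix m n :: int
    show "0 < \<alpha>" by (rule \<alpha>)
    have "G m n (s a x) = s a (G m n x)" for a x
      by (cases "n \<le> m") (auto simp: G_ge G_lt P_scale T_scale b_scale)
    then show "G m n \<in> bounded_operators s s"
      by (simp add: bounded_operators_iff[OF s s])
    show "A m o\<^sub>L G m n = G (m + 1) n - (if m + 1 = n then id_blinfun else 0)"
    proof (rule blinfun_eqI)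
      fix x
      consider "n \<le> m" | "n = m + 1" | "m + 1 < n" by linarith
      then show "(A m o\<^sub>L G m n) x = (G (m + 1) n - (if m + 1 = n then id_blinfun else 0)) x"
        by cases (auto simp: G_ge G_lt transition_add_one transition_self b_left b_refl
            blinfun.diff_left blinfun.minus_right)
    qed
    show "G m (n + 1) o\<^sub>L A n = G m n - (if m = n then id_blinfun else 0)"
    proof (rule blinfun_eqI)
      fix x
      consider "n + 1 \<le> m" | "n = m" | "m < n" by linarith
      then show "(G m (n + 1) o\<^sub>L A n) x = (G m n - (if m = n then id_blinfun else 0)) x"
        by cases (auto simp: G_ge G_lt transition_add_one_right transition_self b_right b_refl
            AP blinfun.diff_left)
    qed
    show "norm (G m n) \<le> K * exp (- \<alpha> * \<bar>m - n\<bar>)"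
    proof (cases "n \<le> m")
      case True
      then show ?thesis
        using forward[OF True] by (simp add: G_def)
    next
      case False
      then show ?thesis
        using K backward[of m n] by (intro norm_blinfun_bound) (auto simp: G_lt b_def)
    qed
  qed
  then show ?thesis by blast
qed

section \<open>Block operators and the triangular system\<close>

lemma block_operator_apply [simp]:
  "block_operator B11 B12 B21 B22 v = (B11 (fst v) + B12 (snd v), B21 (fst v) + B22 (snd v))"
  by transfer simp

lemma block_operator_mem:
  assumes "normed_scaling s1" "normed_scaling s2"
    and "B11 \<in> bounded_operators s1 s1" "B12 \<in> bounded_operators s2 s1"
    and "B21 \<in> bounded_operators s1 s2" "B22 \<in> bounded_operators s2 s2"
  shows "block_operator B11 B12 B21 B22
    \<in> bounded_operators (module_prod.scale s1 s2) (module_prod.scale s1 s2)"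
proof -
  interpret s1: normed_scaling s1 by fact
  interpret s2: normed_scaling s2 by fact
  have prod: "normed_scaling (module_prod.scale s1 s2)"
    using assms(1,2) by (rule normed_scaling_prod)
  show ?thesis
    using assms(3-)
    by (simp add: bounded_operators_iff prod assms(1,2) module_prod_scale_apply
        s1.scale_right_distrib s2.scale_right_distrib)
qed

lemma zero_mem_bounded_operators:
  assumes "normed_scaling s1" "normed_scaling s2"
  shows "0 \<in> bounded_operators s1 s2"
proof -
  interpret s2: normed_scaling s2 by fact
  show ?thesis
    by (simp add: bounded_operators_iff assms)
qed

lemma norm_block_operator_upper:
  fixes B :: "'b::real_normed_vector \<Rightarrow>\<^sub>L 'a::real_normed_vector"
  shows "norm (block_operator 0 B 0 0) \<le> norm B"
proof (rule norm_blinfun_bound)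
  fix v :: "'a \<times> 'b"
  have "norm (B (snd v)) \<le> norm B * norm (snd v)"
    by (rule norm_blinfun)
  also have "\<dots> \<le> norm B * norm v"
    using norm_snd_le[of "snd v" "fst v"] by (intro mult_left_mono) auto
  finally show "norm (block_operator 0 B 0 0 v) \<le> norm B * norm v"
    by (simp add: norm_Pair)
qed simp

text \<open>The second component of the kernel applied to \<open>(x, 0)\<close> is a bounded solution of the
  homogeneous equation on all of \<open>\<int>\<close>.\<close>

lemma green_kernel_block_diagonal:
  fixes A11 :: "int \<Rightarrow> 'a::banach \<Rightarrow>\<^sub>L 'a" and A22 :: "int \<Rightarrow> 'b::banach \<Rightarrow>\<^sub>L 'b"
  assumes "green_kernel s (\<lambda>n. block_operator (A11 n) 0 0 (A22 n)) G K \<alpha>"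
  shows "snd (G m n (x, 0)) = 0"
proof -
  interpret green_kernel s "\<lambda>n. block_operator (A11 n) 0 0 (A22 n)" G K \<alpha> by fact
  define h where "h m = (0::'a, snd (G m n (x, 0)))" for m
  have "h m = 0"
  proof (rule bounded_solution_eq_zero)
    \<comment> \<open>The source \<open>(x, 0)\<close> has no second component, so the jump at
      \<open>n\<close> is invisible to \<open>h\<close>.\<close>
    show "h (i + 1) = block_operator (A11 i) 0 0 (A22 i) (h i)" for i
      using arg_cong[OF apply_kernel_left[of i n "(x, 0)"], of snd]
      by (auto simp: h_def split: if_splits)
    show "norm (h i) \<le> K * norm (x, 0::'b)" for i
      using kernel_bounded[of i n "(x, 0)"] norm_snd_le[of "snd (G i n (x, 0))" "fst (G i n (x, 0))"]
      by (simp add: h_def norm_Pair)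
  qed
  then show ?thesis
    by (simp add: h_def zero_prod_def)
qed

theorem theorem4:
  fixes s1 :: "'k::real_normed_field \<Rightarrow> 'a::{real_inner, banach} \<Rightarrow> 'a"
    and s2 :: "'k \<Rightarrow> 'b::{real_inner, banach} \<Rightarrow> 'b"
    and A11 :: "int \<Rightarrow> 'a \<Rightarrow>\<^sub>L 'a"
    and A12 :: "int \<Rightarrow> 'b \<Rightarrow>\<^sub>L 'a"
    and A22 :: "int \<Rightarrow> 'b \<Rightarrow>\<^sub>L 'b"
  assumes "normed_scaling s1" and "normed_scaling s2"
    and "\<And>n. A11 n \<in> bounded_operators s1 s1"
    and "\<And>n. A12 n \<in> bounded_operators s2 s1"
    and "\<And>n. A22 n \<in> bounded_operators s2 s2"
    and "exponential_dichotomy (module_prod.scale s1 s2) (\<lambda>n. block_operator (A11 n) 0 0 (A22 n))"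
    and "bdd_above (range (\<lambda>n. norm (A12 n)))"
  shows "exponential_dichotomy (module_prod.scale s1 s2)
           (\<lambda>n. block_operator (A11 n) (A12 n) 0 (A22 n))"
proof -
  let ?s = "module_prod.scale s1 s2"
  let ?D = "\<lambda>n. block_operator (A11 n) 0 0 (A22 n)"
  let ?N = "\<lambda>n. block_operator 0 (A12 n) 0 0"
  have scaling: "normed_scaling ?s"
    using assms(1,2) by (rule normed_scaling_prod)
  have "?D n \<in> bounded_operators ?s ?s" for n
    by (intro block_operator_mem zero_mem_bounded_operators assms(1-5))
  then obtain G K \<alpha> where kernel: "green_kernel ?s ?D G K \<alpha>"
    using exponential_dichotomy_imp_green_kernel[OF scaling _ assms(6)] by blast
  interpret green_kernel ?s ?D G K \<alpha> by (rule kernel)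
  obtain M where M: "norm (A12 n) \<le> M" for n
    using assms(7) unfolding bdd_above_def by blast
  have "\<exists>G' K'. green_kernel ?s (\<lambda>n. ?D n + ?N n) G' K' (\<alpha> / 2)"
  proof (rule perturbed_green_kernel)
    show "?N n \<in> bounded_operators ?s ?s" for n
      by (intro block_operator_mem zero_mem_bounded_operators assms(1-5))
    show "norm (?N n) \<le> M" for n
      using norm_block_operator_upper M by (rule order_trans)
    \<comment> \<open>\<open>?N i x\<close> has the form \<open>(y, 0)\<close>; the diagonal kernel
      keeps the second component zero, and \<open>?N j\<close> reads only that component.\<close>
    show "?N j (G j k (?N i x)) = 0" for i j k x
      by (simp add: green_kernel_block_diagonal[OF kernel] zero_prod_def)
  qed
  moreover have "(\<lambda>n. ?D n + ?N n) = (\<lambda>n. block_operator (A11 n) (A12 n) 0 (A22 n))"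
    by (rule ext, rule blinfun_eqI) (simp add: blinfun.add_left)
  ultimately show ?thesis
    by (auto dest: green_kernel.exponential_dichotomy)
qed

end
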